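(* Let $X$ be a nonempty set, and let $\mathfrak{Q}=\{\mathcal{Q}_x\}_{x\in X}$, $\mathcal{Q}=\bigcup_{x\in X}\mathcal{Q}_x$ and the outer measure $\mu$ on $X$ be data satisfying (HL1) and (HL2) of the context. Suppose that $\mathcal{Q}$ satisfies the following five conditions. (D1) The members of $\mathcal{Q}$ are Carathéodory measurable with respect to $\mu$. (D2) $\mathcal{Q}$ is countable. (D3) $Q\cap Q'\in\{Q,Q',\emptyset\}$ for every $Q,Q'\in\mathcal{Q}$. (D4) $\mu(Q)<\mu(Q')$ for every $Q,Q'\in\mathcal{Q}$ with $Q\subsetneq Q'$. (D5) For every $\epsilon>0$ the set $\{\mu(Q):Q\in\mathcal{Q},\ \mu(Q)>\epsilon\}$ has no limit point in $(0,\infty)$. Then $\mathscr{H}^{\mathfrak{Q}}_\mu\leq1$.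
   Context: Let $X$ be a nonempty set. (HL1) For every $x\in X$, $\mathcal{Q}_x$ is a nonempty set of subsets of $X$ such that $x\in Q$ for every $Q\in\mathcal{Q}_x$. Put $\mathfrak{Q}:=\{\mathcal{Q}_x\}_{x\in X}$ and $\mathcal{Q}:=\bigcup_{x}\mathcal{Q}_x$. (HL2) $\mu$ is an outer measure on $X$ such that $0<\mu(Q)<\infty$ for every $Q\in\mathcal{Q}$. For a set function $F:\mathcal{Q}\to[0,\infty]$ define the maximal function $\mathbf{M}^{\mathfrak{Q}}_\mu F:X\to[0,\infty]$ by $\mathbf{M}^{\mathfrak{Q}}_\mu F(x):=\sup_{Q\in\mathcal{Q}_x}\frac{F(Q)}{\mu(Q)}$, and the norm $$\|F\|_{\mathcal{Q}}:=\sup\Big\{\sum_{i=1}^nF(Q_i):Q_1,\ldots,Q_n\in\mathcal{Q},\ Q_i\cap Q_j=\emptyset\text{ for }i\neq j\Big\}.$$ The Hardy-Littlewood maximal constant $\mathscr{H}^{\mathfrak{Q}}_\mu$ is the smallest constant $c$ (the infimum of all finite $c>0$) such that $$\mu\{x\in X:\mathbf{M}^{\mathfrak{Q}}_\mu F(x)>r\}\leq c\,r^{-1}\|F\|_{\mathcal{Q}}$$ for every $r>0$ and every $F:\mathcal{Q}\to[0,\infty]$; $\mathscr{H}^{\mathfrak{Q}}_\mu:=\infty$ if no such finite $c$ exists. *)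

theory Defs
  imports "HOL-Analysis.Analysis"
begin

text \<open>
  The index set \<open>X\<close> is a carrier set, a family \<open>{Q\<^sub>x}\<close> indexed by \<open>X\<close> is a function
  \<open>QQ :: 'a \<Rightarrow> 'a set set\<close> of which only the values at points of \<open>X\<close> are used, and set functions
  on the total family are total functions \<open>'a set \<Rightarrow> ennreal\<close> of which only the values on the
  total family are used.
\<close>

definition total_family :: "'a set \<Rightarrow> ('a \<Rightarrow> 'a set set) \<Rightarrow> 'a set set" where
  "total_family X QQ = (\<Union>x\<in>X. QQ x)"

definition maximal_function ::
  "('a \<Rightarrow> 'a set set) \<Rightarrow> ('a set \<Rightarrow> ennreal) \<Rightarrow> ('a set \<Rightarrow> ennreal) \<Rightarrow> 'a \<Rightarrow> ennreal" where
  "maximal_function QQ \<mu> F x = (SUP Q\<in>QQ x. F Q / \<mu> Q)"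

text \<open>The case \<open>n = 0\<close> only contributes the value \<open>0\<close>, which does not affect the supremum.\<close>

definition set_function_norm :: "'a set set \<Rightarrow> ('a set \<Rightarrow> ennreal) \<Rightarrow> ennreal" where
  "set_function_norm \<Q> F =
     Sup {\<Sum>i=1..n. F (Q i) | (n::nat) Q. Q ` {1..n} \<subseteq> \<Q> \<and> disjoint_family_on Q {1..n}}"

text \<open>The infimum of the empty set is \<open>\<infinity>\<close> in \<open>ennreal\<close>.\<close>

definition hardy_littlewood_constant ::
  "'a set \<Rightarrow> ('a \<Rightarrow> 'a set set) \<Rightarrow> ('a set \<Rightarrow> ennreal) \<Rightarrow> ennreal" where
  "hardy_littlewood_constant X QQ \<mu> =
     Inf {ennreal c | c::real. 0 < c \<and>
       (\<forall>r::real. 0 < r \<longrightarrow> (\<forall>F :: 'a set \<Rightarrow> ennreal.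
          \<mu> {x \<in> X. maximal_function QQ \<mu> F x > ennreal r}
            \<le> ennreal c * inverse (ennreal r) * set_function_norm (total_family X QQ) F))}"

text \<open>
  The library's \<^const>\<open>outer_measure_space\<close> demands countable subadditivity only for disjoint
  families; on a full power set this gives it for arbitrary sequences.
\<close>

lemma outer_measure_space_Pow_subadditive:
  assumes "outer_measure_space (Pow X) \<mu>" and A: "range A \<subseteq> Pow X"
  shows "\<mu> (\<Union>i. A i) \<le> (\<Sum>i. \<mu> (A i :: 'a set) :: ennreal)"
proof -
  have inc: "increasing (Pow X) \<mu>" and sub: "countably_subadditive (Pow X) \<mu>"
    using assms(1) by (auto simp: outer_measure_space_def)
  have D: "range (disjointed A) \<subseteq> Pow X" "(\<Union>i. A i) \<in> Pow X"
    using A disjointed_subset[of A] by fast+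
  have "\<mu> (\<Union>i. A i) = \<mu> (\<Union>i. disjointed A i)"
    by (simp add: UN_disjointed_eq)
  also have "\<dots> \<le> (\<Sum>i. \<mu> (disjointed A i))"
    using sub D disjoint_family_disjointed[of A]
    unfolding countably_subadditive_def by (metis UN_disjointed_eq)
  also have "\<dots> \<le> (\<Sum>i. \<mu> (A i))"
    using D A
    by (intro suminf_le summableI increasingD[OF inc] disjointed_subset) blast+
  finally show ?thesis .
qed

end

theory Submission
  imports Defs
begin

text \<open>
  The set where the maximal function exceeds \<open>r\<close> is covered by the members \<open>Q\<close> of the total family
  with \<open>r \<mu>(Q) < F(Q)\<close>. If the norm of \<open>F\<close> is finite, then these \<open>Q\<close> have bounded measure, so by (D5)
  the measures of those containing a given one form a finite set, and by (D4) each lies in a maximal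
  one. The maximal ones are pairwise disjoint by (D3), and summing over them gives the bound.
\<close>

text \<open>Along an injective enumeration of \<open>M\<close> each partial sum of the series is a
  sum over a finite subfamily, so \<open>B\<close> bounds the series and countable subadditivity
  applies. Padding with the empty set, of measure 0, treats finite and infinite \<open>M\<close> at
  once.\<close>

lemma outer_measure_Union_le:
  fixes \<mu> :: "'a set \<Rightarrow> ennreal"
  assumes om: "outer_measure_space (Pow X) \<mu>"
    and M: "countable M" "M \<subseteq> Pow X"
    and B: "\<And>S. finite S \<Longrightarrow> S \<subseteq> M \<Longrightarrow> sum \<mu> S \<le> B"
  shows "\<mu> (\<Union>M) \<le> B"
proof -
  have empty: "\<mu> {} = 0"
    using om by (simp add: outer_measure_space_def positive_def)
  define I where "I = to_nat_on M ` M"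
  define A where "A i = (if i \<in> I then from_nat_into M i else {})" for i
  have I: "from_nat_into M i \<in> M" if "i \<in> I" for i
    using that M(1) by (auto simp: I_def)
  have inj: "inj_on (from_nat_into M) I"
    using M(1) by (auto simp: I_def inj_on_def)
  have UA: "\<Union>M = (\<Union>i. A i)"
  proof
    show "\<Union>M \<subseteq> (\<Union>i. A i)"
    proof
      fix x assume "x \<in> \<Union>M"
      then obtain Q where Q: "Q \<in> M" "x \<in> Q" by blast
      then have "A (to_nat_on M Q) = Q"
        using M(1) by (simp add: A_def I_def)
      with Q show "x \<in> (\<Union>i. A i)" by blast
    qed
    show "(\<Union>i. A i) \<subseteq> \<Union>M"
      using I by (fastforce simp: A_def split: if_splits)
  qed
  have "\<mu> (\<Union>M) \<le> (\<Sum>i. \<mu> (A i))"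
    unfolding UA using I M(2)
    by (intro outer_measure_space_Pow_subadditive[OF om]) (auto simp: A_def split: if_splits)
  also have "\<dots> \<le> B"
  proof (rule suminf_le_const)
    show "summable (\<lambda>i. \<mu> (A i))" by (rule summableI)
    fix n
    have "(\<Sum>i<n. \<mu> (A i)) = (\<Sum>i\<in>{..<n} \<inter> I. \<mu> (from_nat_into M i))"
      by (subst sum.inter_restrict) (auto simp: A_def empty intro!: sum.cong)
    also have "\<dots> = sum \<mu> (from_nat_into M ` ({..<n} \<inter> I))"
      using inj by (subst sum.reindex) (auto intro: inj_on_subset)
    also have "\<dots> \<le> B"
      using I by (intro B) auto
    finally show "(\<Sum>i<n. \<mu> (A i)) \<le> B" .
  qed
  finally show ?thesis .
qed

text \<open>The norm ranges over indexed tuples; an injective enumeration of \<open>S\<close> turns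
  disjointness of a set of sets into disjointness of an indexed family.\<close>

lemma sum_le_set_function_norm:
  assumes "finite S" "S \<subseteq> \<Q>" "disjoint S"
  shows "sum F S \<le> set_function_norm \<Q> F"
proof -
  obtain h where h: "bij_betw h {1..card S} S"
    using ex_bij_betw_nat_finite_1[OF assms(1)] by blast
  have "disjoint_family_on h {1..card S}"
    using h assms(3)
    by (intro disjoint_image_disjoint_family_on) (auto simp: bij_betw_def)
  moreover have "h ` {1..card S} \<subseteq> \<Q>"
    using h assms(2) by (auto simp: bij_betw_def)
  moreover have "sum F S = (\<Sum>i=1..card S. F (h i))"
    using sum.reindex_bij_betw[OF h, of F] by simp
  ultimately show ?thesis
    unfolding set_function_norm_def by (intro Sup_upper) blast
qed

theorem theorem12:
  fixes X :: "'a set" and QQ :: "'a \<Rightarrow> 'a set set" and \<mu> :: "'a set \<Rightarrow> ennreal"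
    and \<Q> :: "'a set set"
  defines "\<Q> \<equiv> total_family X QQ"
  assumes X: "X \<noteq> {}"
    and HL1: "\<And>x. x \<in> X \<Longrightarrow> QQ x \<noteq> {} \<and> (\<forall>Q\<in>QQ x. Q \<subseteq> X \<and> x \<in> Q)"
    and HL2: "outer_measure_space (Pow X) \<mu>" "\<And>Q. Q \<in> \<Q> \<Longrightarrow> 0 < \<mu> Q \<and> \<mu> Q < \<infinity>"
    and D1: "\<Q> \<subseteq> lambda_system X (Pow X) \<mu>"
    and D2: "countable \<Q>"
    and D3: "\<And>Q Q'. Q \<in> \<Q> \<Longrightarrow> Q' \<in> \<Q> \<Longrightarrow> Q \<inter> Q' \<in> {Q, Q', {}}"
    and D4: "\<And>Q Q'. Q \<in> \<Q> \<Longrightarrow> Q' \<in> \<Q> \<Longrightarrow> Q \<subset> Q' \<Longrightarrow> \<mu> Q < \<mu> Q'"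
    and D5: "\<And>\<epsilon>::real. 0 < \<epsilon> \<Longrightarrow>
      \<not> (\<exists>a::ennreal. 0 < a \<and> a < \<infinity> \<and> a islimpt {\<mu> Q | Q. Q \<in> \<Q> \<and> \<mu> Q > ennreal \<epsilon>})"
  shows "hardy_littlewood_constant X QQ \<mu> \<le> 1"
proof -
  have inc: "increasing (Pow X) \<mu>"
    using HL2(1) by (simp add: outer_measure_space_def)
  have weak: "\<mu> {x \<in> X. maximal_function QQ \<mu> F x > ennreal r}
      \<le> inverse (ennreal r) * set_function_norm \<Q> F" (is "\<mu> ?E \<le> ?c * ?N")
    if r: "0 < r" for r F
  proof (cases "?N = \<infinity>")
    case True
    \<comment> \<open>As \<open>r\<close> is finite, \<open>?c\<close> is nonzero and the right-hand
      side is infinite.\<close>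
    then show ?thesis by (simp add: ennreal_mult_top)
  next
    case False
    \<comment> \<open>The condition on \<open>Q\<close> is divided by \<open>r\<close>, so that it
      bounds \<open>\<mu> Q\<close> directly and can be summed termwise.\<close>
    define A where "A = {Q \<in> \<Q>. \<mu> Q \<le> ?c * F Q}"
    define M where "M = {Q \<in> A. \<forall>Q'\<in>A. \<not> Q \<subset> Q'}"
    have QX: "\<Q> \<subseteq> Pow X"
      using HL1 by (auto simp: \<Q>_def total_family_def)
    have AQ: "A \<subseteq> \<Q>" and MA: "M \<subseteq> A"
      by (auto simp: A_def M_def)
    have single: "F Q \<le> ?N" if "Q \<in> \<Q>" for Q
      using sum_le_set_function_norm[of "{Q}" \<Q> F] that by simp
    have fin: "?c * ?N < \<infinity>"
      using False r by (simp add: ennreal_mult_less_top less_top inverse_ennreal)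
    have bound: "\<mu> Q \<le> ?c * ?N" if "Q \<in> A" for Q
    proof -
      have "\<mu> Q \<le> ?c * F Q" using that by (simp add: A_def)
      also have "\<dots> \<le> ?c * ?N"
        using that AQ by (intro mult_left_mono single) auto
      finally show ?thesis .
    qed
    have cover: "\<exists>Q'\<in>M. Q \<subseteq> Q'" if Q: "Q \<in> A" for Q
    proof -
      define S where "S = \<mu> ` {Q' \<in> A. Q \<subseteq> Q'}"
      have posQ: "0 < \<mu> Q" "\<mu> Q < \<infinity>" using HL2(2) Q AQ by auto
      \<comment> \<open>(D5) takes a real threshold, here strictly below every element of
        \<open>S\<close>. As \<open>d\<close> lies below the finite \<open>\<mu> Q\<close>, its real
        value \<open>e\<close> serves.\<close>
      obtain d where d: "0 < d" "d < \<mu> Q" using dense posQ(1) by blast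
      define e where "e = enn2real d"
      have e: "0 < e" "ennreal e < \<mu> Q"
        using d posQ(2) by (auto simp: e_def enn2real_positive_iff)
      have mono: "\<mu> Q \<le> \<mu> Q'" if "Q' \<in> A" "Q \<subseteq> Q'" for Q'
        using D4[of Q Q'] that Q AQ by (cases "Q = Q'") (auto intro: less_imp_le)
      have "finite S"
      proof (rule ccontr)
        assume "infinite S"
        moreover have S: "S \<subseteq> {\<mu> Q..?c * ?N}"
          using mono bound by (auto simp: S_def)
        \<comment> \<open>The space \<open>ennreal\<close> is compact, so an infinite
          \<open>S\<close> has a limit point. It stays in the closed interval from
          \<open>\<mu> Q\<close> to \<open>?c * ?N\<close>, hence away from 0 and infinity, which
          contradicts (D5).\<close>
        ultimately obtain a where a: "a islimpt S"
          using Heine_Borel_imp_Bolzano_Weierstrass[OF compact_UNIV, of S] by blast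
        then have a_in: "a \<in> {\<mu> Q..?c * ?N}"
          using islimpt_subset[OF a S] closed_atLeastAtMost closed_limpt by metis
        have "S \<subseteq> {\<mu> Q' | Q'. Q' \<in> \<Q> \<and> \<mu> Q' > ennreal e}"
          using less_le_trans[OF e(2) mono] AQ by (auto simp: S_def)
        then have "a islimpt {\<mu> Q' | Q'. Q' \<in> \<Q> \<and> \<mu> Q' > ennreal e}"
          by (rule islimpt_subset[OF a])
        moreover have "0 < a" "a < \<infinity>"
          using less_le_trans[OF posQ(1)] le_less_trans[OF _ fin] a_in by auto
        ultimately show False using D5[OF e(1)] by blast
      qed
      moreover have "S \<noteq> {}" using Q by (auto simp: S_def)
      ultimately have "Max S \<in> S" by (rule Max_in)
      then obtain Q' where Q': "Q' \<in> A" "Q \<subseteq> Q'" "\<mu> Q' = Max S"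
        by (auto simp: S_def)
      \<comment> \<open>A member of \<open>A\<close> strictly above \<open>Q'\<close> still contains
        \<open>Q\<close>, so its measure lies in \<open>S\<close>, while (D4) makes it exceed the
        maximum.\<close>
      have "\<not> Q' \<subset> Q''" if "Q'' \<in> A" for Q''
      proof
        assume sub: "Q' \<subset> Q''"
        then have "\<mu> Q' < \<mu> Q''" using D4 Q' that AQ by blast
        moreover have "\<mu> Q'' \<le> Max S"
          using \<open>finite S\<close> sub Q' that by (intro Max_ge) (auto simp: S_def)
        ultimately show False using Q'(3) by simp
      qed
      then show ?thesis using Q' by (auto simp: M_def)
    qed
    have disj: "disjoint M"
    proof (rule disjointI)
      fix Q Q' assume Q: "Q \<in> M" "Q' \<in> M" "Q \<noteq> Q'"
      then have "\<not> Q \<subset> Q'" "\<not> Q' \<subset> Q" by (auto simp: M_def)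
      moreover have "Q \<inter> Q' \<in> {Q, Q', {}}" using Q MA AQ by (intro D3) auto
      ultimately show "Q \<inter> Q' = {}" using Q(3) by blast
    qed
    have "?E \<subseteq> \<Union>M"
    proof
      fix x assume x: "x \<in> ?E"
      then obtain Q where Q: "Q \<in> QQ x" "ennreal r < F Q / \<mu> Q"
        by (auto simp: maximal_function_def less_SUP_iff)
      have QQ: "Q \<in> \<Q>" "x \<in> Q"
        using x Q HL1 by (auto simp: \<Q>_def total_family_def)
      \<comment> \<open>By contraposition: as \<open>\<mu> Q\<close> is positive,
        \<open>F Q \<le> ennreal r * \<mu> Q\<close> would bound the quotient by
        \<open>r\<close>.\<close>
      have "ennreal r * \<mu> Q \<le> F Q"
        using Q(2) HL2(2)[OF QQ(1)] divide_le_posI_ennreal[of "\<mu> Q" "F Q" "ennreal r"]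
        by (metis linorder_le_cases mult.commute not_le)
      then have "?c * (ennreal r * \<mu> Q) \<le> ?c * F Q"
        by (rule mult_left_mono) simp
      moreover have "?c * ennreal r = 1"
        using r by (simp add: inverse_ennreal ennreal_mult'[symmetric])
      ultimately have "Q \<in> A"
        using QQ by (simp add: A_def mult.assoc[symmetric])
      then show "x \<in> \<Union>M" using cover QQ by blast
    qed
    moreover have "\<Union>M \<subseteq> X" using MA AQ QX by blast
    ultimately have "\<mu> ?E \<le> \<mu> (\<Union>M)"
      by (intro increasingD[OF inc]) auto
    also have "\<dots> \<le> ?c * ?N"
    proof (rule outer_measure_Union_le[OF HL2(1)])
      show "countable M" using D2 MA AQ by (meson countable_subset)
      show "M \<subseteq> Pow X" using MA AQ QX by blast
      \<comment> \<open>Finite subfamilies of \<open>M\<close> inherit disjointness, so their sums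
        of \<open>F\<close> compete in the norm.\<close>
      fix S assume S: "finite S" "S \<subseteq> M"
      have "sum \<mu> S \<le> (\<Sum>Q\<in>S. ?c * F Q)"
        using S MA by (intro sum_mono) (auto simp: A_def)
      also have "\<dots> = ?c * sum F S" by (simp add: sum_distrib_left)
      also have "\<dots> \<le> ?c * ?N"
        using S MA AQ disj
        by (intro mult_left_mono sum_le_set_function_norm) (auto intro: pairwise_subset)
      finally show "sum \<mu> S \<le> ?c * ?N" .
    qed
    finally show ?thesis .
  qed
  \<comment> \<open>By \<open>weak\<close>, the constant 1 is one of those over which the infimum is
    taken.\<close>
  show ?thesis
    unfolding hardy_littlewood_constant_def
    using weak by (intro Inf_lower CollectI exI[of _ 1]) (auto simp: \<Q>_def)
qed

end
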